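(* Let $i\ge 1$ be an integer and $n=9i+5$. The $n$-vertex threshold graphs $G=(0^{2i+1} 1^{3i+3} 0^{2i+1} 1^{2i})$ and $G'=(0^{2i+2} 1^{3i} 0^{2i+1} 1^{2i+2})$ are noncospectral (their adjacency matrices have different spectra) and equienergetic, i.e. $E(G)=E(G')$.
   Context: A threshold graph on $N$ vertices is coded by a binary sequence $(b_1 b_2 \ldots b_N)$ with $b_1=0$: vertices $v_1,\dots,v_N$ are added in order, and for $j\ge 2$ the vertex $v_j$ is added as an isolated vertex if $b_j=0$ and as a dominating vertex (adjacent to all of $v_1,\dots,v_{j-1}$) if $b_j=1$. The notation $(0^{a_1} 1^{a_2} 0^{a_3} 1^{a_4}\cdots)$ denotes the sequence consisting of $a_1$ zeros, followed by $a_2$ ones, followed by $a_3$ zeros, etc. The energy of a graph $H$ on $m$ vertices is $E(H)=\sum_{k=1}^m|\lambda_k|$, where $\lambda_1,\dots,\lambda_m$ are the eigenvalues of its adjacency matrix. *)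

theory Defs
  imports
    "HOL-Library.Z2"
    "HOL-Computational_Algebra.Fundamental_Theorem_Algebra"
    "Jordan_Normal_Form.Char_Poly"
    "Graph_Theory.Pair_Digraph"
begin

text \<open>
  A simple graph is a \<^locale>\<open>pair_graph\<close>: a finite, loop-free digraph with symmetric arc set,
  each edge being represented by its two opposite arcs.
\<close>

definition add_vertex :: "nat \<times> bit \<Rightarrow> nat pair_pre_digraph \<Rightarrow> nat pair_pre_digraph" where
  "add_vertex = (\<lambda>(v, b) G. \<lparr>
     pverts = insert v (pverts G),
     parcs = parcs G \<union> (if b = 1 then {v} \<times> pverts G \<union> pverts G \<times> {v} else {}) \<rparr>)"

text \<open>
  The vertex \<open>v\<^sub>j\<close> is the number \<open>j\<close>.  A code conventionally starts with \<open>0\<close>, but the first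
  entry has no effect: the first vertex is isolated on arrival in either case.
\<close>

definition threshold_graph :: "bit list \<Rightarrow> nat pair_pre_digraph" where
  "threshold_graph bs = fold add_vertex (List.enumerate 1 bs) \<lparr> pverts = {}, parcs = {} \<rparr>"

lemma threshold_graph_Nil: "threshold_graph [] = \<lparr> pverts = {}, parcs = {} \<rparr>"
  by (simp add: threshold_graph_def)

lemma threshold_graph_snoc:
  "threshold_graph (bs @ [b]) = add_vertex (Suc (length bs), b) (threshold_graph bs)"
  by (simp add: threshold_graph_def enumerate_append_eq)

lemma pverts_threshold_graph: "pverts (threshold_graph bs) = {1..length bs}"
  by (induction bs rule: rev_induct)
     (auto simp: threshold_graph_Nil threshold_graph_snoc add_vertex_def)

lemma parcs_threshold_graph:
  "(u, v) \<in> parcs (threshold_graph bs) \<longleftrightarrow>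
     u \<in> {1..length bs} \<and> v \<in> {1..length bs} \<and> u \<noteq> v \<and> bs ! (max u v - 1) = 1"
  by (induction bs rule: rev_induct)
     (auto simp: threshold_graph_Nil threshold_graph_snoc add_vertex_def pverts_threshold_graph
        nth_append max_def not_le not_less le_Suc_eq simp del: bit_not_one_iff split: if_splits)

lemma pair_graph_threshold_graph: "pair_graph (threshold_graph bs)"
proof
  show "finite (parcs (threshold_graph bs))"
    by (rule finite_subset[of _ "{1..length bs} \<times> {1..length bs}"])
       (auto simp: parcs_threshold_graph)
qed (auto simp: pverts_threshold_graph parcs_threshold_graph symmetric_def sym_def max.commute)

text \<open>
  The vertices are listed in increasing order.  The entries are taken in \<^typ>\<open>complex\<close>, so that
  the characteristic polynomial splits and all eigenvalues are counted, without appealing to the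
  fact that the eigenvalues of a symmetric matrix are real.
\<close>

definition adjacency_matrix :: "'a::linorder pair_pre_digraph \<Rightarrow> complex mat" where
  "adjacency_matrix G =
     (let vs = sorted_list_of_set (pverts G) in
      mat (length vs) (length vs) (\<lambda>(j, k). if (vs ! j, vs ! k) \<in> parcs G then 1 else 0))"

text \<open>The multiset of eigenvalues, with algebraic multiplicities.\<close>

definition graph_spectrum :: "'a::linorder pair_pre_digraph \<Rightarrow> complex multiset" where
  "graph_spectrum G = proots (char_poly (adjacency_matrix G))"

lemma size_graph_spectrum: "size (graph_spectrum G) = card (pverts G)"
proof -
  have "adjacency_matrix G \<in> carrier_mat (card (pverts G)) (card (pverts G))"
    by (simp add: adjacency_matrix_def Let_def)
  then show ?thesis
    by (simp add: graph_spectrum_def size_proots_complex degree_monic_char_poly)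
qed

lemma set_mset_graph_spectrum:
  "set_mset (graph_spectrum G) = {k. eigenvalue (adjacency_matrix G) k}"
proof -
  have A: "adjacency_matrix G \<in> carrier_mat (card (pverts G)) (card (pverts G))"
    by (simp add: adjacency_matrix_def Let_def)
  then have "char_poly (adjacency_matrix G) \<noteq> 0"
    using degree_monic_char_poly[OF A] by auto
  with A show ?thesis
    by (simp add: graph_spectrum_def eigenvalue_root_char_poly)
qed

definition energy :: "'a::linorder pair_pre_digraph \<Rightarrow> real" where
  "energy G = (\<Sum>x\<in>#graph_spectrum G. cmod x)"

definition cospectral :: "'a::linorder pair_pre_digraph \<Rightarrow> 'b::linorder pair_pre_digraph \<Rightarrow> bool" where
  "cospectral G H \<longleftrightarrow> graph_spectrum G = graph_spectrum H"

definition equienergetic :: "'a::linorder pair_pre_digraph \<Rightarrow> 'b::linorder pair_pre_digraph \<Rightarrow> bool" where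
  "equienergetic G H \<longleftrightarrow> energy G = energy H"

end

theory Submission
  imports Defs
begin

text \<open>
  Let \<open>P = det (x I - A)\<close>, and let \<open>S\<close> be the sum of the entries of the adjugate of \<open>x I - A\<close>.
  Adding an isolated vertex maps \<open>(P, S)\<close> to \<open>(x P, x S + P)\<close>, and adding a dominating vertex
  maps it to \<open>(x P - S, P + (x + 2) S)\<close>.  The matrices of these linear maps are
  \<open>x\<close> and \<open>x + 1\<close> times the identity plus a nilpotent matrix, so a whole run has
  a closed form.  For the two graphs at hand,
  the characteristic polynomials turn out to be \<open>H (x + 1) (x + 2i + 1)\<close> and \<open>H x (x + 2i + 2)\<close>
  with the same \<open>H\<close>, and \<open>1 + (2i + 1) = 0 + (2i + 2)\<close>.
\<close>

section \<open>Laplace expansions\<close>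

text \<open>Row \<open>n\<close> has at most two nonzero entries. The diagonal one leaves the minor
  in which \<open>s\<close> skips index \<open>n\<close>; the other leaves a minor whose column
  \<open>n\<close> is zero except at the bottom, and the odd index sum \<open>n + Suc n\<close>
  makes its sign negative.\<close>

lemma det_isolate_penultimate:
  fixes f :: "nat \<times> nat \<Rightarrow> 'a::comm_ring_1"
  assumes row: "\<And>k. k < n \<Longrightarrow> f (n, k) = 0" and col: "\<And>j. j < n \<Longrightarrow> f (j, n) = 0"
  defines "s \<equiv> \<lambda>j. if j < n then j else Suc j"
  shows "det (mat (Suc (Suc n)) (Suc (Suc n)) f) =
    f (n, n) * det (mat (Suc n) (Suc n) (\<lambda>(j, k). f (s j, s k)))
    - f (n, Suc n) * f (Suc n, n) * det (mat n n f)"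
proof -
  let ?A = "mat (Suc (Suc n)) (Suc (Suc n)) f"
  let ?B = "mat_delete ?A n (Suc n)"
  have B: "?B \<in> carrier_mat (Suc n) (Suc n)"
    by (auto simp: mat_delete_def)
  have col0: "?B $$ (j, n) = 0" if "j < n" for j
    using that col by (simp add: mat_delete_def)
  have "det ?B = (\<Sum>j<Suc n. ?B $$ (j, n) * cofactor ?B j n)"
    by (rule laplace_expansion_column[OF B]) simp
  also have "\<dots> = ?B $$ (n, n) * cofactor ?B n n"
    using col0 by simp
  also have "?B $$ (n, n) = f (Suc n, n)"
    by (simp add: mat_delete_def)
  also have "mat_delete ?B n n = mat n n f"
    by (auto simp: mat_delete_def)
  then have "cofactor ?B n n = det (mat n n f)"
    by (simp add: cofactor_def flip: mult_2)
  finally have detB: "det ?B = f (Suc n, n) * det (mat n n f)" .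
  have "det ?A = (\<Sum>k<Suc (Suc n). ?A $$ (n, k) * cofactor ?A n k)"
    by (rule laplace_expansion_row) auto
  also have "\<dots> = f (n, n) * cofactor ?A n n + f (n, Suc n) * cofactor ?A n (Suc n)"
    using row by simp
  also have "mat_delete ?A n n = mat (Suc n) (Suc n) (\<lambda>(j, k). f (s j, s k))"
    by (auto simp: mat_delete_def s_def)
  then have "cofactor ?A n n = det (mat (Suc n) (Suc n) (\<lambda>(j, k). f (s j, s k)))"
    by (simp add: cofactor_def flip: mult_2)
  also have "cofactor ?A n (Suc n) = - det ?B"
    by (simp add: cofactor_def)
  finally show ?thesis
    by (simp add: detB mult.assoc)
qed

text \<open>The cofactors along the last row do not see that row, so the determinant is affine in
  the corner entry.\<close>

lemma det_corner:
  fixes f :: "nat \<times> nat \<Rightarrow> 'a::comm_ring_1"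
  shows "det (mat (Suc n) (Suc n) f) =
    f (n, n) * det (mat n n f) + det (mat (Suc n) (Suc n) (f((n, n) := 0)))"
proof -
  let ?A = "mat (Suc n) (Suc n) f" and ?B = "mat (Suc n) (Suc n) (f((n, n) := 0))"
  have cof: "cofactor ?A n k = cofactor ?B n k" if "k \<le> n" for k
    using that unfolding cofactor_def mat_delete_def
    by (intro arg_cong2[of _ _ _ _ "(*)"] refl arg_cong[of _ _ det] cong_mat) auto
  have "mat_delete ?B n n = mat n n f"
    by (auto simp: mat_delete_def)
  then have nn: "cofactor ?B n n = det (mat n n f)"
    by (simp add: cofactor_def flip: mult_2)
  have "det ?A = (\<Sum>k<Suc n. ?A $$ (n, k) * cofactor ?A n k)"
    by (rule laplace_expansion_row) auto
  moreover have "det ?B = (\<Sum>k<Suc n. ?B $$ (n, k) * cofactor ?B n k)"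
    by (rule laplace_expansion_row) auto
  ultimately show ?thesis
    by (simp add: cof nn)
qed

section \<open>Recurrences for one appended bit\<close>

definition threshold_entry :: "'a::comm_ring_1 \<Rightarrow> bit list \<Rightarrow> nat \<times> nat \<Rightarrow> 'a" where
  "threshold_entry x bs = (\<lambda>(j, k). if j = k then x else if bs ! max j k = 1 then -1 else 0)"

definition threshold_det :: "'a::comm_ring_1 \<Rightarrow> bit list \<Rightarrow> 'a" where
  "threshold_det x bs = det (mat (length bs) (length bs) (threshold_entry x bs))"

text \<open>
  The appended bit \<open>1\<close> supplies the border of entries \<open>-1\<close>, so that
  \<open>bordered_det x bs\<close> is the sum of the entries of the adjugate of \<open>x I - A\<close>.
\<close>

definition bordered_det :: "'a::comm_ring_1 \<Rightarrow> bit list \<Rightarrow> 'a" where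
  "bordered_det x bs = - det (mat (Suc (length bs)) (Suc (length bs))
     ((threshold_entry x (bs @ [1]))((length bs, length bs) := 0)))"

lemma threshold_det_Nil: "threshold_det x [] = 1" and bordered_det_Nil: "bordered_det x [] = 0"
  by (simp_all add: threshold_det_def bordered_det_def det_single)

text \<open>Splitting off the corner \<open>x\<close> leaves the bordered matrix if the new vertex
  is dominating, and a matrix with a zero row if it is isolated.\<close>

lemma threshold_det_snoc:
  "threshold_det x (bs @ [b]) = x * threshold_det x bs - (if b = 1 then bordered_det x bs else 0)"
proof -
  let ?n = "length bs"
  have M: "mat ?n ?n (threshold_entry x (bs @ [b])) = mat ?n ?n (threshold_entry x bs)"
    by (intro cong_mat) (auto simp: threshold_entry_def nth_append)
  have nn: "threshold_entry x (bs @ [b]) (?n, ?n) = x"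
    by (simp add: threshold_entry_def)
  have "det (mat (Suc ?n) (Suc ?n) ((threshold_entry x (bs @ [b]))((?n, ?n) := 0))) =
      (if b = 1 then - bordered_det x bs else 0)"
  proof (cases "b = 1")
    case True
    then show ?thesis by (simp add: bordered_det_def)
  next
    case False
    let ?A = "mat (Suc ?n) (Suc ?n) ((threshold_entry x (bs @ [b]))((?n, ?n) := 0))"
    have "det ?A = (\<Sum>k<Suc ?n. ?A $$ (?n, k) * cofactor ?A ?n k)"
      by (rule laplace_expansion_row) auto
    also have "\<dots> = 0"
      using False by (intro sum.neutral) (auto simp: threshold_entry_def nth_append max_def)
    finally show ?thesis using False by simp
  qed
  then show ?thesis
    by (simp add: threshold_det_def det_corner[of ?n "threshold_entry x (bs @ [b])"] M nn)
qed

lemma bordered_det_snoc: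
  "bordered_det x (bs @ [b]) =
    threshold_det x bs + (x + (if b = 1 then 2 else 0)) * bordered_det x bs"
proof -
  let ?n = "length bs" and ?b = "if b = 1 then -1 else 0 :: 'a"
  define f where "f = (threshold_entry x (bs @ [b, 1]))((Suc ?n, Suc ?n) := 0)"
  \<comment> \<open>The entries after the row and column operations below. Each operation adds
    \<open>- ?b\<close> to the diagonal entry \<open>x\<close> of the new vertex, which is where the
    2 in the recurrence comes from.\<close>
  define g where "g = (\<lambda>(j, k). if j < ?n \<and> k < ?n then threshold_entry x bs (j, k)
     else if j = ?n \<and> k = ?n then x - 2 * ?b else if j = Suc ?n \<and> k = Suc ?n then 0
     else if j = Suc ?n \<or> k = Suc ?n then - 1 else 0)"
  let ?A = "mat (Suc (Suc ?n)) (Suc (Suc ?n)) f" and ?B = "mat (Suc (Suc ?n)) (Suc (Suc ?n)) g"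
  \<comment> \<open>The border cancels the off-diagonal entries of the row and column of the new vertex.\<close>
  have "det ?A = det (addcol ?b ?n (Suc ?n) (addrow ?b ?n (Suc ?n) ?A))"
    by (simp add: det_addcol[of _ "Suc (Suc ?n)"] det_addrow[of _ "Suc (Suc ?n)"])
  also have "addcol ?b ?n (Suc ?n) (addrow ?b ?n (Suc ?n) ?A) = ?B"
    by (rule eq_matI)
       (auto simp: f_def g_def threshold_entry_def nth_append max_def less_Suc_eq)
  also have "det ?B = g (?n, ?n) * det (mat (Suc ?n) (Suc ?n)
      (\<lambda>(j, k). g (if j < ?n then j else Suc j, if k < ?n then k else Suc k)))
      - g (?n, Suc ?n) * g (Suc ?n, ?n) * det (mat ?n ?n g)"
    by (rule det_isolate_penultimate) (auto simp: g_def)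
  also have "mat (Suc ?n) (Suc ?n)
      (\<lambda>(j, k). g (if j < ?n then j else Suc j, if k < ?n then k else Suc k)) =
    mat (Suc ?n) (Suc ?n) ((threshold_entry x (bs @ [1]))((?n, ?n) := 0))"
    by (intro cong_mat) (auto simp: g_def threshold_entry_def nth_append max_def)
  also have "mat ?n ?n g = mat ?n ?n (threshold_entry x bs)"
    by (intro cong_mat) (auto simp: g_def)
  finally have "det ?A = - ((x - 2 * ?b) * bordered_det x bs) - threshold_det x bs"
    by (simp only: bordered_det_def threshold_det_def) (simp add: g_def fun_upd_def)
  moreover have "bordered_det x (bs @ [b]) = - det ?A"
    by (simp add: bordered_det_def f_def)
  ultimately have "bordered_det x (bs @ [b]) =
      threshold_det x bs + (x - 2 * ?b) * bordered_det x bs"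
    by simp
  then show ?thesis
    by (cases "b = 1") simp_all
qed

section \<open>Closed forms for runs of equal bits\<close>

lemma replicate_Suc_snoc: "replicate (Suc a) y = replicate a y @ [y]"
  by (simp add: replicate_append_same)

lemma threshold_det_zeros: "threshold_det x (bs @ replicate a 0) = x ^ a * threshold_det x bs"
proof (induction a)
  case (Suc a)
  then show ?case
    by (simp only: replicate_Suc_snoc threshold_det_snoc flip: append_assoc) simp
qed simp

lemma bordered_det_zeros:
  assumes "a > 0"
  shows "bordered_det x (bs @ replicate a 0) =
    x ^ (a - 1) * (x * bordered_det x bs + of_nat a * threshold_det x bs)"
  using assms
proof (induction a rule: nat_induct_non_zero)
  case 1
  then show ?case
    by (simp add: bordered_det_snoc)
next
  case (Suc a)
  have "x ^ a = x * x ^ (a - 1)"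
    using Suc.hyps by (simp add: power_eq_if)
  then show ?case
    by (simp only: replicate_Suc_snoc[of a] bordered_det_snoc threshold_det_zeros Suc.IH
          flip: append_assoc)
       (simp add: algebra_simps)
qed

text \<open>Each dominating vertex multiplies P + S by \<open>x + 1\<close>. Relative to that
  factor, every step therefore moves the same amount P + S from P to S, so the transfer is linear in
  \<open>a\<close>.\<close>

lemma dets_ones:
  assumes "a > 0"
  shows "threshold_det x (bs @ replicate a 1) = (x + 1) ^ (a - 1) *
      ((x + 1) * threshold_det x bs - of_nat a * (threshold_det x bs + bordered_det x bs))"
      (is "?P a")
    and "bordered_det x (bs @ replicate a 1) = (x + 1) ^ (a - 1) *
      ((x + 1) * bordered_det x bs + of_nat a * (threshold_det x bs + bordered_det x bs))"
      (is "?Q a")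
proof -
  have "?P a \<and> ?Q a"
    using assms
  proof (induction a rule: nat_induct_non_zero)
    case 1
    then show ?case
      by (simp add: threshold_det_snoc bordered_det_snoc algebra_simps)
  next
    case (Suc a)
    define w where "w = (x + 1) ^ (a - 1)"
    have "(x + 1) ^ a = (x + 1) * w"
      using Suc.hyps by (simp add: w_def power_eq_if)
    moreover have "threshold_det x (bs @ replicate a 1) =
          w * ((x + 1) * threshold_det x bs - of_nat a * (threshold_det x bs + bordered_det x bs))"
        "bordered_det x (bs @ replicate a 1) =
          w * ((x + 1) * bordered_det x bs + of_nat a * (threshold_det x bs + bordered_det x bs))"
      using Suc.IH by (simp_all add: w_def)
    ultimately show ?case
      by (simp only: replicate_Suc_snoc[of a] threshold_det_snoc bordered_det_snoc diff_Suc_1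
            flip: append_assoc)
         (simp add: algebra_simps)
  qed
  then show "?P a" "?Q a"
    by auto
qed

text \<open>Here \<open>p\<close> and \<open>s\<close> are P and S after the first two runs, without
  the common factor \<open>x ^ (a - 1) * (x + 1) ^ (b - 1)\<close>. Every run contributes a power
  one below its length.\<close>

lemma threshold_det_four_runs:
  fixes x :: "'a::comm_ring_1"
  assumes "a > 0" "b > 0" "c > 0" "d > 0"
  defines "p \<equiv> (x + 1) * x - of_nat b * (x + of_nat a)"
    and "s \<equiv> (x + 1) * of_nat a + of_nat b * (x + of_nat a)"
  shows "threshold_det x (replicate a 0 @ replicate b 1 @ replicate c 0 @ replicate d 1) =
    x ^ (a + c - 2) * (x + 1) ^ (b + d - 2) *
    ((x + 1) * x * p - of_nat d * (x * p + x * s + of_nat c * p))"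
proof -
  define k l m n where "k = a - 1" "l = b - 1" "m = c - 1" "n = d - 1"
  note pred = this[symmetric]
  have P1: "threshold_det x (replicate a 0) = x ^ k * x"
    using threshold_det_zeros[of x "[]" a] assms(1)
    by (simp add: threshold_det_Nil power_eq_if mult.commute flip: pred)
  have S1: "bordered_det x (replicate a 0) = x ^ k * of_nat a"
    using bordered_det_zeros[OF assms(1), of x "[]"] unfolding pred(1)
    by (simp add: threshold_det_Nil bordered_det_Nil)
  have P2: "threshold_det x (replicate a 0 @ replicate b 1) = x ^ k * (x + 1) ^ l * p"
    unfolding dets_ones[OF assms(2)] P1 S1 p_def pred(2)
    by (simp add: algebra_simps)
  have S2: "bordered_det x (replicate a 0 @ replicate b 1) = x ^ k * (x + 1) ^ l * s"
    unfolding dets_ones[OF assms(2)] P1 S1 s_def pred(2)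
    by (simp add: algebra_simps)
  have P3: "threshold_det x ((replicate a 0 @ replicate b 1) @ replicate c 0) =
      x ^ k * (x + 1) ^ l * x ^ m * (x * p)"
    using assms(3) pred(3)
    unfolding threshold_det_zeros P2 by (simp add: power_eq_if[of x c] mult_ac)
  have S3: "bordered_det x ((replicate a 0 @ replicate b 1) @ replicate c 0) =
      x ^ k * (x + 1) ^ l * x ^ m * (x * s + of_nat c * p)"
    unfolding bordered_det_zeros[OF assms(3)] P2 S2 pred(3)
    by (simp add: algebra_simps)
  have "threshold_det x (((replicate a 0 @ replicate b 1) @ replicate c 0) @ replicate d 1) =
      (x ^ k * x ^ m) * ((x + 1) ^ l * (x + 1) ^ n) *
      ((x + 1) * x * p - of_nat d * (x * p + x * s + of_nat c * p))"
    unfolding dets_ones[OF assms(4)] P3 S3 pred(4)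
    by (simp add: algebra_simps)
  moreover have "a + c - 2 = k + m" "b + d - 2 = l + n"
    using assms(1-4) by (simp_all flip: pred)
  ultimately show ?thesis
    by (simp add: power_add)
qed

section \<open>Characteristic polynomials of the two graphs\<close>

lemma char_poly_threshold_graph:
  "char_poly (adjacency_matrix (threshold_graph bs)) = threshold_det [:0, 1:] bs"
proof -
  let ?n = "length bs" and ?vs = "sorted_list_of_set {1..length bs}"
  have vs: "?vs = [1..<Suc ?n]"
    by (metis atLeastLessThanSuc_atLeastAtMost sorted_list_of_set_range)
  \<comment> \<open>Position \<open>j\<close> of the vertex list holds vertex \<open>j + 1\<close>,
    which absorbs the shift in \<open>max u v - 1\<close>.\<close>
  have "adjacency_matrix (threshold_graph bs) =
      mat ?n ?n (\<lambda>(j, k). if j \<noteq> k \<and> bs ! max j k = 1 then 1 else 0)"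
    unfolding adjacency_matrix_def pverts_threshold_graph Let_def vs
    by (intro eq_matI) (auto simp: parcs_threshold_graph simp del: upt_Suc)
  then have "char_poly_matrix (adjacency_matrix (threshold_graph bs)) =
      mat ?n ?n (threshold_entry [:0, 1:] bs)"
    by (intro eq_matI) (auto simp: char_poly_matrix_def threshold_entry_def one_pCons)
  then show ?thesis
    by (simp add: char_poly_def threshold_det_def)
qed

text \<open>The cubic shared by the quartic factors of both graphs. Its roots, whatever they are,
  enter both energies alike.\<close>

definition common_cubic :: "nat \<Rightarrow> 'a::comm_ring_1 \<Rightarrow> 'a" where
  "common_cubic i x = x ^ 3 - (7 * of_nat i + 2) * x ^ 2 - (7 * of_nat i + 3) * x
     + 6 * of_nat i * (of_nat i + 1) * (2 * of_nat i + 1)"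

lemma threshold_det_first_graph:
  fixes x :: "'a::comm_ring_1"
  assumes "i \<ge> 1"
  shows "threshold_det x (replicate (2 * i + 1) 0 @ replicate (3 * i + 3) 1 @
      replicate (2 * i + 1) 0 @ replicate (2 * i) 1) =
    x ^ (4 * i) * (x + 1) ^ (5 * i) * common_cubic i x * ((x + 1) * (x + of_nat (2 * i + 1)))"
proof -
  define t :: 'a where "t = of_nat i"
  have exps: "2 * i + 1 + (2 * i + 1) - 2 = 4 * i" "3 * i + 3 + 2 * i - 2 = Suc (5 * i)"
    by auto
  let ?p = "(x + 1) * x - (3 * t + 3) * (x + (2 * t + 1))"
    and ?s = "(x + 1) * (2 * t + 1) + (3 * t + 3) * (x + (2 * t + 1))"
  \<comment> \<open>Why a linear factor splits off, with a, c, d the first, third and fourth run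
    lengths: at x = -a one has p = a(a - 1) and s = -p, so the quartic takes the value (a(a - 1) -
    cd) p, and here cd = a(a - 1).\<close>
  have quartic: "(x + 1) * x * ?p - (2 * t) * (x * ?p + x * ?s + (2 * t + 1) * ?p) =
      common_cubic i x * (x + (2 * t + 1))"
    unfolding common_cubic_def t_def[symmetric]
    by (simp add: algebra_simps power2_eq_square power3_eq_cube)
  have pos: "2 * i + 1 > 0" "3 * i + 3 > 0" "2 * i + 1 > 0" "2 * i > 0"
    using assms by auto
  have ofs: "of_nat (2 * i + 1) = 2 * t + 1"
    "of_nat (3 * i + 3) = 3 * t + 3" "of_nat (2 * i) = 2 * t"
    by (simp_all add: t_def)
  show ?thesis
    unfolding threshold_det_four_runs[OF pos] exps ofs quartic by (simp add: mult_ac)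
qed

text \<open>The run lengths give the exponents \<open>4 * i + 1\<close> and \<open>5 * i\<close>, so
  the surplus factor is \<open>x\<close>; for the first graph they are \<open>4 * i\<close> and
  \<open>5 * i + 1\<close>, with surplus \<open>x + 1\<close>.\<close>

lemma threshold_det_second_graph:
  fixes x :: "'a::comm_ring_1"
  assumes "i \<ge> 1"
  shows "threshold_det x (replicate (2 * i + 2) 0 @ replicate (3 * i) 1 @
      replicate (2 * i + 1) 0 @ replicate (2 * i + 2) 1) =
    x ^ (4 * i) * (x + 1) ^ (5 * i) * common_cubic i x * (x * (x + of_nat (2 * i + 2)))"
proof -
  define t :: 'a where "t = of_nat i"
  have exps: "2 * i + 2 + (2 * i + 1) - 2 = Suc (4 * i)" "3 * i + (2 * i + 2) - 2 = 5 * i"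
    by auto
  let ?p = "(x + 1) * x - (3 * t) * (x + (2 * t + 2))"
    and ?s = "(x + 1) * (2 * t + 2) + (3 * t) * (x + (2 * t + 2))"
  \<comment> \<open>Again cd = a(a - 1), now with a = 2i + 2.\<close>
  have quartic: "(x + 1) * x * ?p - (2 * t + 2) * (x * ?p + x * ?s + (2 * t + 1) * ?p) =
      common_cubic i x * (x + (2 * t + 2))"
    unfolding common_cubic_def t_def[symmetric]
    by (simp add: algebra_simps power2_eq_square power3_eq_cube)
  have pos: "2 * i + 2 > 0" "3 * i > 0" "2 * i + 1 > 0" "2 * i + 2 > 0"
    using assms by auto
  have ofs: "of_nat (2 * i + 1) = 2 * t + 1"
    "of_nat (3 * i) = 3 * t" "of_nat (2 * i + 2) = 2 * t + 2"
    by (simp_all add: t_def)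
  show ?thesis
    unfolding threshold_det_four_runs[OF pos] exps ofs quartic by (simp add: mult_ac)
qed

theorem theorem3:
  fixes i n :: nat and G G' :: "nat pair_pre_digraph"
  assumes "i \<ge> 1"
    and "n = 9 * i + 5"
    and "G = threshold_graph
          (replicate (2 * i + 1) 0 @ replicate (3 * i + 3) 1 @
           replicate (2 * i + 1) 0 @ replicate (2 * i) 1)"
    and "G' = threshold_graph
          (replicate (2 * i + 2) 0 @ replicate (3 * i) 1 @
           replicate (2 * i + 1) 0 @ replicate (2 * i + 2) 1)"
  shows "card (pverts G) = n \<and> card (pverts G') = n \<and>
         \<not> cospectral G G' \<and> equienergetic G G'"
proof -
  define X :: "complex poly" where "X = [:0, 1:]"
  define H where "H = X ^ (4 * i) * (X + 1) ^ (5 * i) * common_cubic i X"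
  have lin: "X + of_nat k = [:of_nat k, 1:]" for k
    by (simp add: X_def of_nat_poly)
  have G: "char_poly (adjacency_matrix G) = H * ([:1, 1:] * [:of_nat (2 * i + 1), 1:])"
    using threshold_det_first_graph[OF assms(1), of X] lin[of 1] lin[of "2 * i + 1"]
    unfolding assms(3) char_poly_threshold_graph H_def by (simp flip: X_def)
  have G': "char_poly (adjacency_matrix G') = H * ([:0, 1:] * [:of_nat (2 * i + 2), 1:])"
    using threshold_det_second_graph[OF assms(1), of X] lin[of "2 * i + 2"]
    unfolding assms(4) char_poly_threshold_graph H_def by (simp flip: X_def)
  \<comment> \<open>\<open>proots\<close> turns products into sums only for nonzero factors;
    \<open>H\<close> is nonzero because it divides a monic polynomial.\<close>
  have "char_poly (adjacency_matrix G) \<noteq> 0"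
    using degree_monic_char_poly[of "adjacency_matrix G" "card (pverts G)"]
    by (auto simp: adjacency_matrix_def Let_def)
  with G have "H \<noteq> 0"
    by auto
  have spec: "graph_spectrum G = proots H + {#-1, - of_nat (2 * i + 1)#}"
    unfolding graph_spectrum_def G using \<open>H \<noteq> 0\<close>
    by (simp add: proots_mult del: mult_pCons_left mult_pCons_right)
  have spec': "graph_spectrum G' = proots H + {#0, - of_nat (2 * i + 2)#}"
    unfolding graph_spectrum_def G' using \<open>H \<noteq> 0\<close>
    by (simp add: proots_mult del: mult_pCons_left mult_pCons_right)
  \<comment> \<open>Both spectra contain 0, as \<open>X\<close> divides \<open>H\<close>. They
    differ in its multiplicity, so \<open>proots H\<close> has to be cancelled first.\<close>
  have "of_nat (2 * i + 1) \<noteq> (0 :: complex)"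
    by (simp only: of_nat_eq_0_iff)
  then have "0 \<notin># {#-1, - of_nat (2 * i + 1) :: complex#}"
    by (simp del: of_nat_add of_nat_mult of_nat_Suc)
  then have "\<not> cospectral G G'"
    unfolding cospectral_def spec spec' by (metis add_left_cancel union_single_eq_member)
  moreover have "equienergetic G G'"
    unfolding equienergetic_def energy_def spec spec'
    by (simp only: image_mset_union sum_mset.union image_mset_add_mset image_mset_empty
        sum_mset.add_mset sum_mset.empty norm_minus_cancel norm_of_nat norm_one norm_zero)
  ultimately show ?thesis
    using assms(2) by (simp add: assms(3,4) pverts_threshold_graph)
qed

end
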